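(* Let $K$ be a finite oriented $n$-dimensional simplicial complex embedded in $\mathbb{R}^N$, and let $G$ be a finite group acting on $K$ by simplicial isomorphisms that are (restrictions of) exact isometries of $\mathbb{R}^N$. Then: (i) The circumcentric dual $\star K$ is invariant under $G$, in the sense that $g(\star\sigma)=\star(g\sigma)$ for every simplex $\sigma\in K$ and every $g\in G$. (ii) For every $0\le k\le n$ the discrete Hodge star $\star_k:\Omega_d^k(K)\to\Omega_d^{n-k}(\star K)$ is equivariant: $$\star_k\circ\rho^k(g)=\rho^{n-k}(g)\circ\star_k\qquad\text{for all } g\in G.$$
   Context: Primal side. $C_k(K)$ is the real vector space of oriented $k$-chains, in which reversing the orientation of a simplex $\sigma$ gives $-\sigma$. $\Omega_d^k(K):=\mathrm{Hom}(C_k(K),\mathbb{R})$, with pairing $\langle\alpha,\sigma\rangle:=\alpha(\sigma)$. $G$ acts on chains by $g[v_0,\dots,v_k]=[gv_0,\dots,gv_k]$, and $\rho^k:G\to\mathrm{GL}(\Omega_d^k(K))$ is defined by $\langle\rho^k(g)\alpha,\sigma\rangle:=\langle\alpha,g^{-1}\sigma\rangle$. Dual cells. The circumcenter $c_\sigma$ of a simplex $\sigma$ is the unique point of the affine span of $\sigma$ equidistant from its vertices. For a $k$-simplex $\sigma$, the circumcentric dual $(n-k)$-cell $\star\sigma$ is the formal signed sum, over all flags $\sigma=\sigma^k\subset\sigma^{k+1}\subset\dots\subset\sigma^n$ of simplices of $K$ ($\dim\sigma^j=j$), of the (possibly degenerate) elementary simplices with vertices $(c_{\sigma^k},c_{\sigma^{k+1}},\dots,c_{\sigma^n})$;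 the sign of a flag is the product over $j=k,\dots,n-1$ of $+1$ if $c_{\sigma^{j+1}}$ lies, inside the affine span of $\sigma^{j+1}$, on the same side of the affine span of $\sigma^j$ as the vertex of $\sigma^{j+1}$ not in $\sigma^j$ (or on it), and $-1$ otherwise. All signs are $+1$ when every simplex contains its circumcenter in its interior, and then $\star\sigma$ is the usual geometric cell, the union of these elementary simplices. An isometry $g$ acts on such a sum by moving the vertices of the elementary simplices. $|\star\sigma|$ is the corresponding signed sum of $(n-k)$-dimensional Euclidean volumes, and $|\sigma|$ is the $k$-dimensional Euclidean volume of $\sigma$ (the volume of a point is $1$). Dual cochains. $C_{n-k}(\star K)$ is the real vector space generated by the symbols $\star\sigma$, $\sigma$ an oriented $k$-simplex, with $\star(-\sigma)=-\star\sigma$; $\Omega_d^{n-k}(\star K):=\mathrm{Hom}(C_{n-k}(\star K),\mathbb{R})$. The group acts on dual chains through the action on cells, with orientation transported along with that of $\sigma$, i.e. the oriented dual cell $\star\sigma$ is sent to the oriented dual cell $\star(g\sigma)$; the representation on dual cochains (again written $\rho^{n-k}$) is $\langle\rho^{n-k}(g)\beta,\star\sigma\rangle:=\langle\beta,g^{-1}(\star\sigma)\rangle$. Discrete Hodge star. $\star_k:\Omega_d^k(K)\to\Omega_d^{n-k}(\star K)$ is defined by $\langle\star_k\alpha,\star\sigma\rangle:=\dfrac{|\star\sigma|}{|\sigma|}\langle\alpha,\sigma\rangle$. *)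

theory Defs
  imports "HOL-Analysis.Analysis" "HOL-Analysis.Finite_Function_Topology" "HOL-Algebra.Group_Action"
begin

section \<open>Oriented simplicial complexes and isometric actions\<close>

text \<open>
  Complexes are geometric: \<^const>\<open>simplicial_complex\<close> is a finite set of convex sets, and
  \<open>int k simplex \<sigma>\<close> says that \<open>\<sigma>\<close> is the convex hull of \<open>k + 1\<close> affinely independent points.
  A complex also contains the empty face, of dimension \<open>-1\<close>.
\<close>

definition vertices :: "'a::real_vector set \<Rightarrow> 'a set" where
  "vertices \<sigma> = {v. v extreme_point_of \<sigma>}"

definition vertex_ordering :: "'a::real_vector list \<Rightarrow> 'a set \<Rightarrow> bool" where
  "vertex_ordering vs \<sigma> \<longleftrightarrow> distinct vs \<and> set vs = vertices \<sigma>"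

text \<open>
  The orientation of \<open>\<sigma>\<close> is the class of the ordering \<open>ori \<sigma>\<close> up to even permutations.
  Purity is not required: a simplex lying in no \<open>n\<close>-simplex has no flags, hence dual cell \<open>0\<close>.
\<close>

definition oriented_complex ::
    "nat \<Rightarrow> 'a::euclidean_space set set \<Rightarrow> ('a set \<Rightarrow> 'a list) \<Rightarrow> bool" where
  "oriented_complex n K ori \<longleftrightarrow>
     simplicial_complex K \<and>
     (\<exists>\<sigma>\<in>K. int n simplex \<sigma>) \<and> (\<forall>\<sigma>\<in>K. aff_dim \<sigma> \<le> int n) \<and>
     (\<forall>\<sigma>\<in>K. vertex_ordering (ori \<sigma>) \<sigma>)"

definition simplicial_automorphism :: "'a::euclidean_space set set \<Rightarrow> ('a \<Rightarrow> 'a) \<Rightarrow> bool" where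
  "simplicial_automorphism K f \<longleftrightarrow>
     bij_betw f (\<Union>K) (\<Union>K) \<and> bij_betw ((`) f) K K \<and>
     (\<forall>\<sigma>\<in>K. \<forall>x\<in>\<sigma>. \<forall>y\<in>\<sigma>. \<forall>u\<in>{0..1}.
        f ((1 - u) *\<^sub>R x + u *\<^sub>R y) = (1 - u) *\<^sub>R f x + u *\<^sub>R f y)"

text \<open>
  \<open>act g\<close> is an isometry of the whole space restricting to the action of \<open>g\<close> on the polyhedron
  \<open>\<Union>K\<close>. Only the restrictions have to form a group action, since the isometries extending them
  need not be unique when \<open>\<Union>K\<close> does not affinely span the space.
\<close>

definition isometric_simplicial_action ::
    "('g, 'm) monoid_scheme \<Rightarrow> 'a::euclidean_space set set \<Rightarrow> ('g \<Rightarrow> 'a \<Rightarrow> 'a) \<Rightarrow> bool" where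
  "isometric_simplicial_action G K act \<longleftrightarrow>
     group_action G (\<Union>K) (\<lambda>g. restrict (act g) (\<Union>K)) \<and>
     (\<forall>g\<in>carrier G. simplicial_automorphism K (act g)) \<and>
     (\<forall>g\<in>carrier G. \<forall>x y. dist (act g x) (act g y) = dist x y)"


section \<open>Euclidean volume in dimension \<open>k\<close>\<close>

definition affine_frame :: "nat \<Rightarrow> 'a::euclidean_space \<Rightarrow> (nat \<Rightarrow> 'a) \<Rightarrow> (nat \<Rightarrow> real) \<Rightarrow> 'a" where
  "affine_frame k p e x = p + (\<Sum>i<k. x i *\<^sub>R e i)"

text \<open>
  Lebesgue measure of \<open>S\<close> in Cartesian coordinates on a \<open>k\<close>-dimensional affine subspace
  containing \<open>S\<close>; the value does not depend on the origin \<open>p\<close> and orthonormal directions \<open>e\<close>.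
  Sets of affine dimension below \<open>k\<close> get volume \<open>0\<close>, and a point has \<open>0\<close>-dimensional volume \<open>1\<close>.
\<close>

definition euclidean_volume :: "nat \<Rightarrow> 'a::euclidean_space set \<Rightarrow> real" where
  "euclidean_volume k S =
     (THE v. \<exists>p e. (\<forall>i<k. \<forall>j<k. e i \<bullet> e j = (if i = j then 1 else 0)) \<and>
        S \<subseteq> range (affine_frame k p e) \<and>
        v = measure (\<Pi>\<^sub>M i\<in>{..<k}. lborel)
              {x \<in> space (\<Pi>\<^sub>M i\<in>{..<k}. lborel). affine_frame k p e x \<in> S})"


section \<open>Linear extension\<close>

text \<open>Formal real combinations of symbols are finitely supported functions.\<close>

definition lin_extend :: "('x \<Rightarrow> 'v::real_vector) \<Rightarrow> ('x \<Rightarrow>\<^sub>0 real) \<Rightarrow> 'v" where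
  "lin_extend h c = (\<Sum>x\<in>Poly_Mapping.keys c. Poly_Mapping.lookup c x *\<^sub>R h x)"

lemma lin_extend_superset:
  assumes "finite A" "Poly_Mapping.keys c \<subseteq> A"
  shows "lin_extend h c = (\<Sum>x\<in>A. Poly_Mapping.lookup c x *\<^sub>R h x)"
  unfolding lin_extend_def using assms
  by (intro sum.mono_neutral_left) (auto simp: in_keys_iff)

lemma lookup_scaleR: "Poly_Mapping.lookup (r *\<^sub>R c) x = r *\<^sub>R Poly_Mapping.lookup c x"
  by (simp add: scaleR_poly_mapping_def)

lemma linear_lin_extend: "linear (lin_extend h)"
proof (rule linearI)
  fix c d :: "'a \<Rightarrow>\<^sub>0 real" and r :: real
  let ?A = "Poly_Mapping.keys c \<union> Poly_Mapping.keys d"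
  have "lin_extend h (c + d) = (\<Sum>x\<in>?A. Poly_Mapping.lookup (c + d) x *\<^sub>R h x)"
    by (rule lin_extend_superset) (auto simp: in_keys_iff lookup_add)
  also have "\<dots> = (\<Sum>x\<in>?A. Poly_Mapping.lookup c x *\<^sub>R h x)
                 + (\<Sum>x\<in>?A. Poly_Mapping.lookup d x *\<^sub>R h x)"
    by (simp add: lookup_add scaleR_add_left sum.distrib)
  also have "\<dots> = lin_extend h c + lin_extend h d"
    by (metis (no_types) finite_UnI finite_keys lin_extend_superset sup_ge1 sup_ge2)
  finally show "lin_extend h (c + d) = lin_extend h c + lin_extend h d" .
  have "lin_extend h (r *\<^sub>R c) = (\<Sum>x\<in>Poly_Mapping.keys c. Poly_Mapping.lookup (r *\<^sub>R c) x *\<^sub>R h x)"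
    by (rule lin_extend_superset) (auto simp: in_keys_iff lookup_scaleR)
  then show "lin_extend h (r *\<^sub>R c) = r *\<^sub>R lin_extend h c"
    by (simp add: lin_extend_def lookup_scaleR scaleR_sum_right)
qed

lemma lin_extend_single: "lin_extend h (Poly_Mapping.single x r) = r *\<^sub>R h x"
  by (simp add: lin_extend_def)


section \<open>Circumcentric dual cells\<close>

definition circumcenter :: "'a::euclidean_space set \<Rightarrow> 'a" where
  "circumcenter \<sigma> = (THE c. c \<in> affine hull \<sigma> \<and> (\<exists>r. \<forall>v\<in>vertices \<sigma>. dist c v = r))"

text \<open>A flag \<open>\<sigma>\<^sup>k \<subset> \<dots> \<subset> \<sigma>\<^sup>n\<close> is a list whose entry at index \<open>i\<close> is \<open>\<sigma>\<^sup>k\<^sup>+\<^sup>i\<close>.\<close>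

definition flags :: "nat \<Rightarrow> 'a::euclidean_space set set \<Rightarrow> nat \<Rightarrow> 'a set \<Rightarrow> 'a set list set" where
  "flags n K k \<sigma> =
     {F. length F = n - k + 1 \<and> F ! 0 = \<sigma> \<and>
         (\<forall>i\<le>n - k. F ! i \<in> K \<and> int (k + i) simplex F ! i) \<and>
         (\<forall>i<n - k. F ! i \<subset> F ! Suc i)}"

definition opposite_vertex :: "'a::euclidean_space set \<Rightarrow> 'a set \<Rightarrow> 'a" where
  "opposite_vertex \<tau> \<sigma> = (THE v. v \<in> vertices \<sigma> \<and> v \<notin> \<tau>)"

text \<open>
  Inside the affine span of \<open>\<sigma>\<close>, a point off the hyperplane spanned by the facet \<open>\<tau>\<close> is on the
  same side of it as the opposite vertex iff the segment joining them misses the hyperplane.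
\<close>

definition facet_sign :: "'a::euclidean_space set \<Rightarrow> 'a set \<Rightarrow> real" where
  "facet_sign \<tau> \<sigma> =
     (if circumcenter \<sigma> \<in> affine hull \<tau> \<or>
         closed_segment (circumcenter \<sigma>) (opposite_vertex \<tau> \<sigma>) \<inter> affine hull \<tau> = {}
      then 1 else - 1)"

definition flag_sign :: "'a::euclidean_space set list \<Rightarrow> real" where
  "flag_sign F = (\<Prod>i<length F - 1. facet_sign (F ! i) (F ! Suc i))"

text \<open>An elementary simplex, possibly degenerate, is represented by its tuple of vertices.\<close>

definition dual_cell ::
    "nat \<Rightarrow> 'a::euclidean_space set set \<Rightarrow> nat \<Rightarrow> 'a set \<Rightarrow> ('a list \<Rightarrow>\<^sub>0 real)" where
  "dual_cell n K k \<sigma> =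
     (\<Sum>F\<in>flags n K k \<sigma>. flag_sign F *\<^sub>R Poly_Mapping.single (map circumcenter F) 1)"

definition move_cell :: "('a \<Rightarrow> 'a) \<Rightarrow> ('a list \<Rightarrow>\<^sub>0 real) \<Rightarrow> ('a list \<Rightarrow>\<^sub>0 real)" where
  "move_cell f = lin_extend (\<lambda>cs. Poly_Mapping.single (map f cs) 1)"

definition cell_volume :: "nat \<Rightarrow> ('a::euclidean_space list \<Rightarrow>\<^sub>0 real) \<Rightarrow> real" where
  "cell_volume m = lin_extend (\<lambda>cs. euclidean_volume m (convex hull (set cs)))"


section \<open>Chains and cochains\<close>

text \<open>
  \<open>alternate b vs\<close> is the oriented simplex \<open>[v\<^sub>0, \<dots>, v\<^sub>k]\<close>, realised as an antisymmetrised
  combination of the symbols \<open>b [v\<^sub>\<pi>\<^sub>0, \<dots>, v\<^sub>\<pi>\<^sub>k]\<close>, so that an odd permutation of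
  the vertices changes its sign. Oriented simplices with distinct underlying simplices have
  disjoint supports, so there are no further relations between them.
\<close>

definition alternate :: "('a list \<Rightarrow> 'x) \<Rightarrow> 'a list \<Rightarrow> ('x \<Rightarrow>\<^sub>0 real)" where
  "alternate b vs =
     (\<Sum>p | p permutes {..<length vs}.
        of_int (sign p) *\<^sub>R Poly_Mapping.single (b (permute_list p vs)) 1)"

lemma alternate_permute:
  assumes "q permutes {..<length vs}"
  shows "alternate b (permute_list q vs) = of_int (sign q) *\<^sub>R alternate b vs"
proof -
  let ?P = "{p. p permutes {..<length vs}}"
  let ?f = "\<lambda>p. of_int (sign p) *\<^sub>R Poly_Mapping.single (b (permute_list p vs)) (1::real)"
  have "alternate b vs = (\<Sum>p\<in>?P. ?f (q \<circ> p))"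
    unfolding alternate_def
    by (rule sum.reindex_bij_betw[symmetric], rule bij_betw_byWitness[where f' = "\<lambda>p. inv_into UNIV q \<circ> p"])
       (auto simp: o_assoc permutes_inv_o[OF assms] assms permutes_inv intro!: permutes_compose)
  also have "\<dots> = (\<Sum>p\<in>?P. of_int (sign q) *\<^sub>R
      (of_int (sign p) *\<^sub>R Poly_Mapping.single (b (permute_list p (permute_list q vs))) 1))"
  proof (rule sum.cong[OF refl])
    fix p assume "p \<in> ?P"
    then have p: "p permutes {..<length vs}" by simp
    have "sign (q \<circ> p) = sign q * sign p"
      by (rule sign_compose) (use assms p permutation_permutes in blast)+
    with p assms show "?f (q \<circ> p) = of_int (sign q) *\<^sub>R
      (of_int (sign p) *\<^sub>R Poly_Mapping.single (b (permute_list p (permute_list q vs))) 1)"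
      by (simp add: permute_list_compose)
  qed
  also have "\<dots> = of_int (sign q) *\<^sub>R alternate b (permute_list q vs)"
    by (simp add: alternate_def scaleR_sum_right)
  finally have "of_int (sign q) *\<^sub>R alternate b vs
      = (of_int (sign q) * of_int (sign q)) *\<^sub>R alternate b (permute_list q vs)"
    by simp
  then show ?thesis
    by (simp flip: of_int_mult)
qed

lemma lin_extend_alternate:
  assumes "\<And>p. p permutes {..<length vs} \<Longrightarrow>
      h (b (permute_list p vs)) = r *\<^sub>R Poly_Mapping.single (b' (permute_list p vs)) 1"
  shows "lin_extend h (alternate b vs) = r *\<^sub>R alternate b' vs"
proof -
  have "lin_extend h (alternate b vs) =
      (\<Sum>p | p permutes {..<length vs}. of_int (sign p) *\<^sub>R h (b (permute_list p vs)))"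
    unfolding alternate_def
    by (simp add: linear_sum[OF linear_lin_extend] linear_scale[OF linear_lin_extend]
        lin_extend_single)
  also have "\<dots> = r *\<^sub>R alternate b' vs"
    unfolding alternate_def scaleR_sum_right
    by (rule sum.cong[OF refl]) (use assms in \<open>auto simp: mult.commute\<close>)
  finally show ?thesis .
qed

definition ordered_simplices :: "'a::euclidean_space set set \<Rightarrow> nat \<Rightarrow> 'a list set" where
  "ordered_simplices K k = {vs. \<exists>\<sigma>\<in>K. int k simplex \<sigma> \<and> vertex_ordering vs \<sigma>}"

abbreviation oriented_simplex :: "'a list \<Rightarrow> ('a list \<Rightarrow>\<^sub>0 real)" where
  "oriented_simplex \<equiv> alternate (\<lambda>vs. vs)"

datatype 'a dual_symbol = Star (unstar: "'a list")

abbreviation oriented_dual :: "'a list \<Rightarrow> ('a dual_symbol \<Rightarrow>\<^sub>0 real)" where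
  "oriented_dual \<equiv> alternate Star"

definition chains :: "'a::euclidean_space set set \<Rightarrow> nat \<Rightarrow> ('a list \<Rightarrow>\<^sub>0 real) set" where
  "chains K k = span (oriented_simplex ` ordered_simplices K k)"

text \<open>\<open>dual_chains K k\<close> is generated by the duals of the \<open>k\<close>-simplices: its degree is \<open>n - k\<close>.\<close>

definition dual_chains :: "'a::euclidean_space set set \<Rightarrow> nat \<Rightarrow> ('a dual_symbol \<Rightarrow>\<^sub>0 real) set" where
  "dual_chains K k = span (oriented_dual ` ordered_simplices K k)"

definition linear_functionals :: "'v::real_vector set \<Rightarrow> ('v \<Rightarrow> real) set" where
  "linear_functionals V =
     {\<alpha> \<in> extensional V. (\<forall>x\<in>V. \<forall>y\<in>V. \<alpha> (x + y) = \<alpha> x + \<alpha> y) \<and>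
                        (\<forall>r. \<forall>x\<in>V. \<alpha> (r *\<^sub>R x) = r * \<alpha> x)}"

abbreviation cochains :: "'a::euclidean_space set set \<Rightarrow> nat \<Rightarrow> (('a list \<Rightarrow>\<^sub>0 real) \<Rightarrow> real) set" where
  "cochains K k \<equiv> linear_functionals (chains K k)"

abbreviation dual_cochains ::
    "'a::euclidean_space set set \<Rightarrow> nat \<Rightarrow> (('a dual_symbol \<Rightarrow>\<^sub>0 real) \<Rightarrow> real) set" where
  "dual_cochains K k \<equiv> linear_functionals (dual_chains K k)"


section \<open>Group action on cochains and the discrete Hodge star\<close>

definition move_chain :: "('a \<Rightarrow> 'a) \<Rightarrow> ('a list \<Rightarrow>\<^sub>0 real) \<Rightarrow> ('a list \<Rightarrow>\<^sub>0 real)" where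
  "move_chain f = lin_extend (\<lambda>vs. Poly_Mapping.single (map f vs) 1)"

definition move_dual_chain ::
    "('a \<Rightarrow> 'a) \<Rightarrow> ('a dual_symbol \<Rightarrow>\<^sub>0 real) \<Rightarrow> ('a dual_symbol \<Rightarrow>\<^sub>0 real)" where
  "move_dual_chain f = lin_extend (\<lambda>s. Poly_Mapping.single (Star (map f (unstar s))) 1)"

lemma move_chain_oriented_simplex:
  "move_chain f (oriented_simplex vs) = oriented_simplex (map f vs)"
  by (simp add: move_chain_def alternate_def linear_sum[OF linear_lin_extend]
      linear_scale[OF linear_lin_extend] lin_extend_single permute_list_map)

lemma move_dual_chain_oriented_dual:
  "move_dual_chain f (oriented_dual vs) = oriented_dual (map f vs)"
  by (simp add: move_dual_chain_def alternate_def linear_sum[OF linear_lin_extend]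
      linear_scale[OF linear_lin_extend] lin_extend_single permute_list_map)

definition cochain_rep ::
    "('g, 'm) monoid_scheme \<Rightarrow> 'a::euclidean_space set set \<Rightarrow> ('g \<Rightarrow> 'a \<Rightarrow> 'a) \<Rightarrow> nat \<Rightarrow>
     'g \<Rightarrow> (('a list \<Rightarrow>\<^sub>0 real) \<Rightarrow> real) \<Rightarrow> ('a list \<Rightarrow>\<^sub>0 real) \<Rightarrow> real" where
  "cochain_rep G K act k g \<alpha> = (\<lambda>c\<in>chains K k. \<alpha> (move_chain (act (inv\<^bsub>G\<^esub> g)) c))"

definition dual_cochain_rep ::
    "('g, 'm) monoid_scheme \<Rightarrow> 'a::euclidean_space set set \<Rightarrow> ('g \<Rightarrow> 'a \<Rightarrow> 'a) \<Rightarrow> nat \<Rightarrow>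
     'g \<Rightarrow> (('a dual_symbol \<Rightarrow>\<^sub>0 real) \<Rightarrow> real) \<Rightarrow> ('a dual_symbol \<Rightarrow>\<^sub>0 real) \<Rightarrow> real" where
  "dual_cochain_rep G K act k g \<beta> =
     (\<lambda>c\<in>dual_chains K k. \<beta> (move_dual_chain (act (inv\<^bsub>G\<^esub> g)) c))"

definition hodge_ratio :: "nat \<Rightarrow> 'a::euclidean_space set set \<Rightarrow> nat \<Rightarrow> 'a set \<Rightarrow> real" where
  "hodge_ratio n K k \<sigma> = cell_volume (n - k) (dual_cell n K k \<sigma>) / euclidean_volume k \<sigma>"

text \<open>
  The Hodge star is prescribed on the generators \<open>\<star>\<sigma>\<close>; its linear extension is precomposition
  with the map \<open>\<star>\<sigma> \<mapsto> (\<bar>\<star>\<sigma>\<bar> / \<bar>\<sigma>\<bar>) \<sigma>\<close> from dual chains to chains. The lemma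
  \<open>hodge_star_oriented_dual\<close> recovers the prescription.
\<close>

definition hodge_star ::
    "nat \<Rightarrow> 'a::euclidean_space set set \<Rightarrow> nat \<Rightarrow>
     (('a list \<Rightarrow>\<^sub>0 real) \<Rightarrow> real) \<Rightarrow> ('a dual_symbol \<Rightarrow>\<^sub>0 real) \<Rightarrow> real" where
  "hodge_star n K k \<alpha> =
     (\<lambda>c\<in>dual_chains K k.
        \<alpha> (lin_extend (\<lambda>s. hodge_ratio n K k (convex hull (set (unstar s))) *\<^sub>R
                            Poly_Mapping.single (unstar s) 1) c))"

lemma hodge_star_oriented_dual:
  assumes \<alpha>: "\<alpha> \<in> cochains K k" and vs: "vs \<in> ordered_simplices K k"
  shows "hodge_star n K k \<alpha> (oriented_dual vs)
           = hodge_ratio n K k (convex hull (set vs)) * \<alpha> (oriented_simplex vs)"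
proof -
  have "oriented_dual vs \<in> dual_chains K k" "oriented_simplex vs \<in> chains K k"
    using vs by (auto simp: dual_chains_def chains_def intro: span_base)
  moreover have "lin_extend (\<lambda>s. hodge_ratio n K k (convex hull (set (unstar s))) *\<^sub>R
      Poly_Mapping.single (unstar s) 1) (oriented_dual vs)
      = hodge_ratio n K k (convex hull (set vs)) *\<^sub>R oriented_simplex vs"
    by (rule lin_extend_alternate) simp
  ultimately show ?thesis
    using \<alpha> by (simp add: hodge_star_def linear_functionals_def)
qed

lemma hodge_star_dual_cochain:
  assumes \<alpha>: "\<alpha> \<in> cochains K k"
  shows "hodge_star n K k \<alpha> \<in> dual_cochains K k"
proof -
  let ?W = "lin_extend (\<lambda>s. hodge_ratio n K k (convex hull (set (unstar s))) *\<^sub>R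
      Poly_Mapping.single (unstar s) (1::real))"
  have gen: "?W (oriented_dual vs) = hodge_ratio n K k (convex hull (set vs)) *\<^sub>R oriented_simplex vs"
    for vs :: "'a list"
    by (rule lin_extend_alternate) simp
  have W: "?W c \<in> chains K k" if "c \<in> dual_chains K k" for c
    using that unfolding dual_chains_def
  proof (induction rule: span_induct_alt)
    case base
    then show ?case
      by (simp add: linear_0[OF linear_lin_extend] chains_def span_zero)
  next
    case (step r x y)
    then obtain vs where "vs \<in> ordered_simplices K k" "x = oriented_dual vs" by auto
    with step(2) show ?case
      by (auto simp: linear_add[OF linear_lin_extend] linear_scale[OF linear_lin_extend] gen
          chains_def intro!: span_add span_scale intro: span_base)
  qed
  show ?thesis
    using \<alpha> W
    by (auto simp: linear_functionals_def hodge_star_def linear_add[OF linear_lin_extend]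
        linear_scale[OF linear_lin_extend] dual_chains_def span_add span_scale)
qed

end

theory Submission
  imports Defs
begin

text \<open>
  Everything that enters the dual cells and the Hodge star is metric. An isometry of the whole
  space is a translation after an orthogonal map, so it commutes with affine and convex hulls and
  preserves simplices and their vertices. The circumcenter of a simplex and the vertex opposite a
  facet are determined by such data alone, and an object so determined is carried along by the
  isometry (\<open>the_image\<close>), once it is known to exist and to be unique
  (\<open>affine_independent_circumcenter\<close>, \<open>simplex_opposite_vertex\<close>). A symmetry of the complex
  therefore preserves the sign of every flag and carries its elementary simplex to that of the
  image flag. Since it also permutes the flags of \<open>K\<close>, bijectively from those starting
  at \<open>\<sigma>\<close> to those starting at \<open>f ` \<sigma>\<close>, the sums defining the dual cells correspond
  (\<open>dual_cell_image\<close>).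

  Euclidean volumes are preserved because an orthonormal frame can be moved by the isometry
  together with the set that is measured. With the invariance of dual cells this makes
  \<open>\<bar>\<star>\<sigma>\<bar> / \<bar>\<sigma>\<bar>\<close> constant on orbits (\<open>hodge_ratio_image\<close>). The Hodge star and the
  two representations are all precompositions with linear maps on chains, so its equivariance is
  dual to a commuting square of chain maps (\<open>hodge_transpose_equivariant\<close>); on generators that
  square says precisely that the ratio is invariant.
\<close>

section \<open>Isometries of Euclidean space\<close>

locale euclidean_isometry =
  fixes f :: "'a::euclidean_space \<Rightarrow> 'a"
  assumes dist_image: "dist (f x) (f y) = dist x y"
begin

definition linear_part :: "'a \<Rightarrow> 'a" where
  "linear_part x = f x - f 0"

lemma linear_part: "orthogonal_transformation linear_part"
  unfolding orthogonal_transformation_isometry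
  using dist_image by (simp add: linear_part_def dist_norm)

lemma linear_linear_part: "linear linear_part"
  using linear_part by (rule orthogonal_transformation_linear)

lemma inj_linear_part: "inj linear_part"
  using linear_part by (rule orthogonal_transformation_inj)

lemma translation_after_linear_part: "f x = f 0 + linear_part x"
  by (simp add: linear_part_def)

lemma image_translation_after_linear_part: "f ` S = (+) (f 0) ` linear_part ` S"
  by (simp add: image_image flip: translation_after_linear_part)

lemma bij: "bij f"
proof -
  have "bij linear_part"
    using linear_part by (rule orthogonal_transformation_bij)
  then have "bij ((+) (f 0) \<circ> linear_part)"
    by (rule bij_comp) (simp add: bij_def)
  moreover have "(+) (f 0) \<circ> linear_part = f"
    by (auto simp: linear_part_def)
  ultimately show ?thesis
    by simp
qed

lemma inj: "inj f" and surj: "surj f"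
  using bij by (simp_all add: bij_def)

lemma image_mem_iff: "f x \<in> f ` S \<longleftrightarrow> x \<in> S"
  using inj by (rule inj_image_mem_iff)

lemma inverse_isometry: "euclidean_isometry (inv_into UNIV f)"
  by standard (metis dist_image surj surj_f_inv_f)

lemma affine_hull_image: "affine hull (f ` S) = f ` (affine hull S)"
  by (simp add: image_translation_after_linear_part[of "affine hull S"]
      image_translation_after_linear_part[of S] affine_hull_translation
      affine_hull_linear_image linear_linear_part linear_conv_bounded_linear[symmetric])

lemma convex_hull_image: "convex hull (f ` S) = f ` (convex hull S)"
  by (simp add: image_translation_after_linear_part[of "convex hull S"]
      image_translation_after_linear_part[of S] convex_hull_translation
      convex_hull_linear_image linear_linear_part)

lemma closed_segment_image: "closed_segment (f a) (f b) = f ` closed_segment a b"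
  using convex_hull_image[of "{a, b}"] by (simp add: segment_convex_hull)

lemma open_segment_image: "open_segment (f a) (f b) = f ` open_segment a b"
  using inj by (simp add: open_segment_def closed_segment_image image_set_diff)

lemma vertices_image: "vertices (f ` S) = f ` vertices S"
  by (auto simp: vertices_def extreme_point_of_def open_segment_image dest!: injD[OF inj])

lemma simplex_image: "m simplex f ` S" if "m simplex S"
proof -
  obtain C where C: "finite C" "\<not> affine_dependent C" "int (card C) = m + 1" "S = convex hull C"
    using \<open>m simplex S\<close> by (auto simp: simplex)
  have card: "card (f ` C) = card C"
    using inj by (meson card_image inj_on_subset subset_UNIV)
  have "aff_dim (f ` C) = aff_dim C"
    by (simp add: image_translation_after_linear_part aff_dim_translation_eq
        aff_dim_injective_linear_image linear_linear_part inj_linear_part)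
  then have "\<not> affine_dependent (f ` C)"
    using C card by (simp add: affine_independent_iff_card)
  then show ?thesis
    using C card by (auto simp: simplex simp flip: convex_hull_image)
qed

text \<open>
  Definite descriptions that do not denote need not be respected by \<open>f\<close>, hence the
  uniqueness premise.
\<close>

lemma the_image: "(THE y. Q y) = f (THE x. P x)"
  if "\<exists>!x. P x" and "\<And>x. Q (f x) \<longleftrightarrow> P x"
proof (rule the_equality)
  show "Q (f (THE x. P x))"
    using that theI'[of P] by simp
next
  fix y
  assume "Q y"
  moreover obtain x where "y = f x"
    using surj by blast
  ultimately show "y = f (THE x. P x)"
    using that by (metis the1_equality)
qed

end


section \<open>Circumcenters, opposite vertices and their equivariance\<close>

text \<open>
  The prescribed values extend to a linear functional, which the inner product represents by a
  vector; projecting that vector to \<open>span B\<close> does not change its inner products with \<open>B\<close>.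
  The difference of two solutions lies in \<open>span B\<close> and is orthogonal to it.
\<close>

lemma independent_inner_solution:
  fixes B :: "'a::euclidean_space set"
  assumes "independent B"
  shows "\<exists>!y. y \<in> span B \<and> (\<forall>b\<in>B. y \<bullet> b = \<phi> b)"
proof (rule ex_ex1I)
  obtain h where h: "linear h" "\<And>b. b \<in> B \<Longrightarrow> h b = \<phi> b"
    using linear_independent_extend[OF assms] by blast
  obtain y z where yz: "y \<in> span B" "\<And>w. w \<in> span B \<Longrightarrow> orthogonal z w" "adjoint h (1::real) = y + z"
    by (metis orthogonal_subspace_decomp_exists)
  have "y \<bullet> b = \<phi> b" if "b \<in> B" for b
  proof -
    have "\<phi> b = b \<bullet> adjoint h 1"
      using h that by (simp add: adjoint_works)
    moreover have "z \<bullet> b = 0"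
      using yz(2)[of b] that by (simp add: span_base orthogonal_def)
    ultimately show ?thesis
      by (simp add: yz(3) inner_commute inner_add_right)
  qed
  then show "\<exists>y. y \<in> span B \<and> (\<forall>b\<in>B. y \<bullet> b = \<phi> b)"
    using yz(1) by blast
next
  fix y z
  assume y: "y \<in> span B \<and> (\<forall>b\<in>B. y \<bullet> b = \<phi> b)" and z: "z \<in> span B \<and> (\<forall>b\<in>B. z \<bullet> b = \<phi> b)"
  have "orthogonal (y - z) w" if "w \<in> span B" for w
    using that by (rule orthogonal_to_span) (use y z in \<open>simp add: orthogonal_def inner_diff_left\<close>)
  moreover have "y - z \<in> span B"
    using y z by (simp add: span_diff)
  ultimately have "orthogonal (y - z) (y - z)"
    by blast
  then show "y = z"
    by (simp add: orthogonal_self)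
qed

text \<open>
  Relative to a vertex \<open>a\<close>, a center is \<open>a + y\<close> with \<open>y\<close> in the span of the edge
  vectors \<open>b\<close> at \<open>a\<close>. Squaring \<open>norm (y - b) = norm y\<close> removes the quadratic term in
  \<open>y\<close> and leaves the linear conditions \<open>y \<bullet> b = b \<bullet> b / 2\<close>.
\<close>

lemma affine_independent_circumcenter:
  fixes C :: "'a::euclidean_space set"
  assumes "\<not> affine_dependent C" and "C \<noteq> {}"
  shows "\<exists>!c. c \<in> affine hull C \<and> (\<exists>r. \<forall>v\<in>C. dist c v = r)"
proof -
  obtain a where a: "a \<in> C"
    using assms(2) by blast
  define B where "B = (\<lambda>x. - a + x) ` (C - {a})"
  have "independent B"
    using assms(1) affine_dependent_iff_dependent2[OF a] by (simp add: B_def)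
  then have ex1: "\<exists>!y. y \<in> span B \<and> (\<forall>b\<in>B. y \<bullet> b = b \<bullet> b / 2)"
    by (rule independent_inner_solution)
  have hull: "affine hull C = (+) a ` span B"
    using affine_hull_span2[OF a] by (simp add: B_def)
  have equidistant: "(\<exists>r. \<forall>v\<in>C. dist (a + y) v = r) \<longleftrightarrow> (\<forall>b\<in>B. y \<bullet> b = b \<bullet> b / 2)" for y
  proof -
    have "(\<exists>r. \<forall>v\<in>C. dist (a + y) v = r) \<longleftrightarrow> (\<forall>v\<in>C - {a}. dist (a + y) v = norm y)"
      using a by (force simp: dist_norm)
    also have "\<dots> \<longleftrightarrow> (\<forall>b\<in>B. norm (y - b) = norm y)"
      by (simp add: B_def dist_norm algebra_simps)
    also have "\<dots> \<longleftrightarrow> (\<forall>b\<in>B. y \<bullet> b = b \<bullet> b / 2)"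
      by (intro ball_cong refl) (auto simp: norm_eq inner_diff_left inner_diff_right inner_commute)
    finally show ?thesis .
  qed
  have "\<exists>!y. a + y \<in> affine hull C \<and> (\<exists>r. \<forall>v\<in>C. dist (a + y) v = r)"
    using ex1 by (auto simp: equidistant hull)
  then show ?thesis
    by (metis add.commute diff_add_cancel)
qed

lemma simplex_vertices:
  assumes "m simplex \<sigma>"
  shows "\<not> affine_dependent (vertices \<sigma>)" and "int (card (vertices \<sigma>)) = m + 1"
    and "convex hull vertices \<sigma> = \<sigma>"
proof -
  obtain C where C: "\<not> affine_dependent C" "int (card C) = m + 1" "\<sigma> = convex hull C"
    using assms by (auto simp: simplex)
  then have "vertices \<sigma> = C"
    by (auto simp: vertices_def extreme_point_of_convex_hull_affine_independent)
  with C show "\<not> affine_dependent (vertices \<sigma>)" "int (card (vertices \<sigma>)) = m + 1"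
    "convex hull vertices \<sigma> = \<sigma>"
    by simp_all
qed

lemma simplex_circumcenter:
  assumes "int k simplex \<sigma>"
  shows "\<exists>!c. c \<in> affine hull \<sigma> \<and> (\<exists>r. \<forall>v\<in>vertices \<sigma>. dist c v = r)"
proof -
  have "vertices \<sigma> \<noteq> {}"
    using simplex_vertices(2)[OF assms] by auto
  then show ?thesis
    using affine_independent_circumcenter[OF simplex_vertices(1)[OF assms]]
    by (metis affine_hull_convex_hull assms simplex_vertices(3))
qed

text \<open>
  The vertices of a face are those vertices of \<open>\<sigma>\<close> that lie in it, so counting leaves exactly
  one outside a facet.
\<close>

lemma simplex_opposite_vertex:
  assumes \<tau>: "int j simplex \<tau>" and \<sigma>: "int (Suc j) simplex \<sigma>" and face: "\<tau> face_of \<sigma>"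
  shows "\<exists>!v. v \<in> vertices \<sigma> \<and> v \<notin> \<tau>"
proof -
  have eq: "vertices \<tau> = vertices \<sigma> \<inter> \<tau>"
    using extreme_point_of_face[OF face] by (auto simp: vertices_def)
  have "card (vertices \<sigma>) = Suc (Suc j)" "card (vertices \<tau>) = Suc j"
    using simplex_vertices(2)[OF \<tau>] simplex_vertices(2)[OF \<sigma>] by simp_all
  then have "card (vertices \<sigma> - \<tau>) = 1"
    by (simp add: card_Diff_subset_Int eq card_ge_0_finite flip: eq)
  then obtain v where "vertices \<sigma> - \<tau> = {v}"
    by (rule card_1_singletonE)
  then have "u \<in> vertices \<sigma> \<and> u \<notin> \<tau> \<longleftrightarrow> u = v" for u
    by blast
  then show ?thesis
    by simp
qed

context euclidean_isometry
begin

lemma circumcenter_image: "circumcenter (f ` \<sigma>) = f (circumcenter \<sigma>)" if "int k simplex \<sigma>"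
  unfolding circumcenter_def using simplex_circumcenter[OF that]
  by (rule the_image) (simp add: affine_hull_image image_mem_iff vertices_image dist_image)

lemma opposite_vertex_image: "opposite_vertex (f ` \<tau>) (f ` \<sigma>) = f (opposite_vertex \<tau> \<sigma>)"
  if "int j simplex \<tau>" "int (Suc j) simplex \<sigma>" "\<tau> face_of \<sigma>"
  unfolding opposite_vertex_def using simplex_opposite_vertex[OF that]
  by (rule the_image) (simp add: image_mem_iff vertices_image)

lemma facet_sign_image: "facet_sign (f ` \<tau>) (f ` \<sigma>) = facet_sign \<tau> \<sigma>"
  if "int j simplex \<tau>" "int (Suc j) simplex \<sigma>" "\<tau> face_of \<sigma>"
proof -
  have "f ` A \<inter> f ` B = {} \<longleftrightarrow> A \<inter> B = {}" for A B
    using inj by (simp flip: image_Int)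
  then show ?thesis
    unfolding facet_sign_def circumcenter_image[OF that(2)] opposite_vertex_image[OF that]
    by (simp add: affine_hull_image closed_segment_image image_mem_iff)
qed

end


section \<open>Equivariance of the dual cells\<close>

locale isometric_symmetry = euclidean_isometry f
  for f :: "'a::euclidean_space \<Rightarrow> 'a" and K :: "'a set set" +
  assumes complex: "simplicial_complex K"
    and image_complex: "bij_betw ((`) f) K K"
begin

lemma image_in_complex: "\<sigma> \<in> K \<Longrightarrow> f ` \<sigma> \<in> K"
  using image_complex by (auto simp: bij_betw_def)

text \<open>This makes the map induced by \<open>f\<close> on flags surjective.\<close>

lemma inverse_symmetry: "isometric_symmetry (inv_into UNIV f) K"
proof -
  have cancel: "inv_into UNIV f ` f ` \<sigma> = \<sigma>" "f ` inv_into UNIV f ` \<sigma> = \<sigma>" for \<sigma>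
    using inj surj by (simp_all add: image_f_inv_f)
  have "bij_betw ((`) (inv_into UNIV f)) K K"
  proof (rule bij_betw_byWitness[where f' = "(`) f"])
    have "K = (`) f ` K"
      using image_complex by (simp add: bij_betw_def)
    then have "(`) (inv_into UNIV f) ` K = (`) (inv_into UNIV f) ` (`) f ` K"
      by simp
    also have "\<dots> = K"
      by (simp only: image_image[of "(`) (inv_into UNIV f)"] cancel(1) image_ident)
    finally show "(`) (inv_into UNIV f) ` K \<subseteq> K"
      by simp
    show "(`) f ` K \<subseteq> K"
      using image_in_complex by blast
  qed (simp_all add: cancel)
  then show ?thesis
    using inverse_isometry complex
    by (simp add: isometric_symmetry_def isometric_symmetry_axioms_def)
qed

lemma flags_image: "map ((`) f) F \<in> flags n K k (f ` \<sigma>)" if "F \<in> flags n K k \<sigma>"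
proof -
  have "f ` A \<subset> f ` B \<longleftrightarrow> A \<subset> B" for A B
    using inj by (simp add: inj_image_subset_iff psubset_eq inj_image_eq_iff)
  then show ?thesis
    using that by (auto simp: flags_def simplex_image image_in_complex nth_map)
qed

lemma bij_betw_flags: "bij_betw (map ((`) f)) (flags n K k \<sigma>) (flags n K k (f ` \<sigma>))"
proof (rule bij_betw_byWitness[where f' = "map ((`) (inv_into UNIV f))"])
  interpret inverse: isometric_symmetry "inv_into UNIV f" K
    by (rule inverse_symmetry)
  have cancel: "(`) (inv_into UNIV f) \<circ> (`) f = id" "(`) f \<circ> (`) (inv_into UNIV f) = id"
    using inj surj by (auto simp: fun_eq_iff image_f_inv_f)
  then show "\<forall>F\<in>flags n K k \<sigma>. map ((`) (inv_into UNIV f)) (map ((`) f) F) = F"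
    and "\<forall>F\<in>flags n K k (f ` \<sigma>). map ((`) f) (map ((`) (inv_into UNIV f)) F) = F"
    by simp_all
  show "map ((`) f) ` flags n K k \<sigma> \<subseteq> flags n K k (f ` \<sigma>)"
    by (auto intro: flags_image)
  have "inv_into UNIV f ` f ` \<sigma> = \<sigma>"
    using inj by simp
  then show "map ((`) (inv_into UNIV f)) ` flags n K k (f ` \<sigma>) \<subseteq> flags n K k \<sigma>"
    by (metis image_subsetI inverse.flags_image)
qed

lemma flag_sign_image: "flag_sign (map ((`) f) F) = flag_sign F" if "F \<in> flags n K k \<sigma>"
  unfolding flag_sign_def length_map
proof (rule prod.cong[OF refl])
  fix i
  assume "i \<in> {..<length F - 1}"
  then have i: "i < n - k" "Suc i < length F"
    using that by (auto simp: flags_def)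
  have entry: "F ! j \<in> K \<and> int (k + j) simplex F ! j" if "j \<le> n - k" for j
    using \<open>F \<in> flags n K k \<sigma>\<close> that by (simp add: flags_def)
  have face: "F ! i \<in> K" "F ! Suc i \<in> K" "F ! i \<subset> F ! Suc i"
    "int (k + i) simplex F ! i" "int (Suc (k + i)) simplex F ! Suc i"
    using entry[of i] entry[of "Suc i"] that i by (simp_all add: flags_def)
  \<comment> \<open>Flags only ask for inclusions, but nested simplices of a complex intersect in a common face.\<close>
  have "(F ! Suc i \<inter> F ! i) face_of F ! Suc i"
    using complex face(1,2) by (auto simp: simplicial_complex_def)
  then have "F ! i face_of F ! Suc i"
    using face(3) by (simp add: Int_absorb1 psubset_imp_subset)
  then show "facet_sign (map ((`) f) F ! i) (map ((`) f) F ! Suc i) = facet_sign (F ! i) (F ! Suc i)"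
    using facet_sign_image[OF face(4,5)] i by simp
qed

lemma circumcenters_image: "map circumcenter (map ((`) f) F) = map f (map circumcenter F)"
  if "F \<in> flags n K k \<sigma>"
proof -
  have "circumcenter (f ` \<tau>) = f (circumcenter \<tau>)" if \<tau>: "\<tau> \<in> set F" for \<tau>
  proof -
    obtain i where "i \<le> n - k" "\<tau> = F ! i"
      using \<open>F \<in> flags n K k \<sigma>\<close> \<tau>
      by (auto simp: flags_def in_set_conv_nth less_Suc_eq_le)
    then have "int (k + i) simplex \<tau>"
      using \<open>F \<in> flags n K k \<sigma>\<close> by (simp add: flags_def)
    then show ?thesis
      by (rule circumcenter_image)
  qed
  then show ?thesis
    by simp
qed

text \<open>
  Termwise comparison of the two sums, after reindexing the second one by the bijection between
  the flags that start at \<open>\<sigma>\<close> and those that start at its image.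
\<close>

theorem dual_cell_image: "move_cell f (dual_cell n K k \<sigma>) = dual_cell n K k (f ` \<sigma>)"
proof -
  have "dual_cell n K k (f ` \<sigma>) = (\<Sum>F\<in>flags n K k \<sigma>. flag_sign (map ((`) f) F) *\<^sub>R
      Poly_Mapping.single (map circumcenter (map ((`) f) F)) 1)"
    unfolding dual_cell_def by (rule sum.reindex_bij_betw[OF bij_betw_flags, symmetric])
  also have "\<dots> = (\<Sum>F\<in>flags n K k \<sigma>. flag_sign F *\<^sub>R
      Poly_Mapping.single (map f (map circumcenter F)) 1)"
    by (intro sum.cong refl) (simp only: flag_sign_image circumcenters_image)
  also have "\<dots> = move_cell f (dual_cell n K k \<sigma>)"
    by (simp add: move_cell_def dual_cell_def linear_sum[OF linear_lin_extend]
        linear_scale[OF linear_lin_extend] lin_extend_single)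
  finally show ?thesis ..
qed

end


section \<open>Invariance of volumes and of the Hodge ratios\<close>

context euclidean_isometry
begin

lemma affine_frame_image:
  "affine_frame k (f p) (\<lambda>i. linear_part (e i)) x = f (affine_frame k p e x)"
  unfolding affine_frame_def translation_after_linear_part[of p]
    translation_after_linear_part[of "p + (\<Sum>i<k. x i *\<^sub>R e i)"]
  by (simp add: linear_add[OF linear_linear_part] linear_sum[OF linear_linear_part]
      linear_scale[OF linear_linear_part])

text \<open>
  Moving the origin of the frame by \<open>f\<close> and its directions by the linear part of \<open>f\<close> gives
  the points of \<open>f ` S\<close> the same coordinates as the original frame gives those of \<open>S\<close>, so
  the measured subsets of coordinate space are literally equal.
\<close>

lemma frame_measure_image:
  assumes "\<forall>i<k. \<forall>j<k. e i \<bullet> e j = (if i = j then 1 else 0)"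
    and "S \<subseteq> range (affine_frame k p e)"
    and "v = measure (\<Pi>\<^sub>M i\<in>{..<k}. lborel)
              {x \<in> space (\<Pi>\<^sub>M i\<in>{..<k}. lborel). affine_frame k p e x \<in> S}"
  shows "\<exists>p e. (\<forall>i<k. \<forall>j<k. e i \<bullet> e j = (if i = j then 1 else 0)) \<and>
           f ` S \<subseteq> range (affine_frame k p e) \<and>
           v = measure (\<Pi>\<^sub>M i\<in>{..<k}. lborel)
              {x \<in> space (\<Pi>\<^sub>M i\<in>{..<k}. lborel). affine_frame k p e x \<in> f ` S}"
proof (intro exI conjI)
  show "\<forall>i<k. \<forall>j<k. linear_part (e i) \<bullet> linear_part (e j) = (if i = j then 1 else 0)"
    using assms(1) linear_part by (simp add: orthogonal_transformation_def)
  show "f ` S \<subseteq> range (affine_frame k (f p) (\<lambda>i. linear_part (e i)))"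
    using assms(2) by (auto simp: affine_frame_image)
  show "v = measure (\<Pi>\<^sub>M i\<in>{..<k}. lborel) {x \<in> space (\<Pi>\<^sub>M i\<in>{..<k}. lborel).
      affine_frame k (f p) (\<lambda>i. linear_part (e i)) x \<in> f ` S}"
    using assms(3) by (simp add: affine_frame_image image_mem_iff)
qed

text \<open>
  By the preceding lemma, for \<open>f\<close> and for its inverse, the descriptions that define the two
  volumes are satisfied by the same numbers.
\<close>

lemma euclidean_volume_image: "euclidean_volume k (f ` S) = euclidean_volume k S"
proof -
  interpret inverse: euclidean_isometry "inv_into UNIV f"
    by (rule inverse_isometry)
  have "inv_into UNIV f ` f ` S = S"
    using inj by simp
  then have preimage: "S = inv_into UNIV f ` f ` S"
    by simp
  show ?thesis
    unfolding euclidean_volume_def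
  proof (intro arg_cong[where f = The] ext iffI; elim exE conjE)
    fix v p e
    assume *: "\<forall>i<k. \<forall>j<k. e i \<bullet> e j = (if i = j then 1 else 0)"
      "f ` S \<subseteq> range (affine_frame k p e)"
      "v = measure (\<Pi>\<^sub>M i\<in>{..<k}. lborel)
              {x \<in> space (\<Pi>\<^sub>M i\<in>{..<k}. lborel). affine_frame k p e x \<in> f ` S}"
    show "\<exists>p e. (\<forall>i<k. \<forall>j<k. e i \<bullet> e j = (if i = j then 1 else 0)) \<and>
           S \<subseteq> range (affine_frame k p e) \<and>
           v = measure (\<Pi>\<^sub>M i\<in>{..<k}. lborel)
              {x \<in> space (\<Pi>\<^sub>M i\<in>{..<k}. lborel). affine_frame k p e x \<in> S}"
      by (subst (1 2) preimage) (rule inverse.frame_measure_image[OF *])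
  qed (rule frame_measure_image)
qed

end

lemma lin_extend_compose_single:
  "lin_extend h (lin_extend (\<lambda>x. Poly_Mapping.single (t x) 1) c) = lin_extend (\<lambda>x. h (t x)) c"
  by (simp add: lin_extend_def[of "\<lambda>x. Poly_Mapping.single (t x) 1"]
      lin_extend_def[of "\<lambda>x. h (t x)"] linear_sum[OF linear_lin_extend]
      linear_scale[OF linear_lin_extend] lin_extend_single)

lemma (in euclidean_isometry) cell_volume_move_cell: "cell_volume m (move_cell f c) = cell_volume m c"
  by (simp add: cell_volume_def move_cell_def lin_extend_compose_single
      convex_hull_image euclidean_volume_image)

lemma (in isometric_symmetry) hodge_ratio_image: "hodge_ratio n K k (f ` \<sigma>) = hodge_ratio n K k \<sigma>"
  by (simp add: hodge_ratio_def cell_volume_move_cell euclidean_volume_image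
      flip: dual_cell_image)


section \<open>Equivariance of the discrete Hodge star\<close>

text \<open>
  The map \<open>\<star>\<sigma> \<mapsto> (\<bar>\<star>\<sigma>\<bar> / \<bar>\<sigma>\<bar>) \<sigma>\<close> from dual chains to chains, whose
  transpose is the Hodge star.
\<close>

definition hodge_transpose ::
    "nat \<Rightarrow> 'a::euclidean_space set set \<Rightarrow> nat \<Rightarrow> ('a dual_symbol \<Rightarrow>\<^sub>0 real) \<Rightarrow> ('a list \<Rightarrow>\<^sub>0 real)" where
  "hodge_transpose n K k =
     lin_extend (\<lambda>s. hodge_ratio n K k (convex hull (set (unstar s))) *\<^sub>R
       Poly_Mapping.single (unstar s) 1)"

lemma hodge_transpose_oriented_dual:
  "hodge_transpose n K k (oriented_dual vs) =
     hodge_ratio n K k (convex hull (set vs)) *\<^sub>R oriented_simplex vs"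
  unfolding hodge_transpose_def by (rule lin_extend_alternate) simp

lemma linear_image_in_span:
  assumes "linear T" and "\<And>b. b \<in> B \<Longrightarrow> T b \<in> span B'" and "x \<in> span B"
  shows "T x \<in> span B'"
proof -
  have "T x \<in> span (T ` B)"
    using assms by (metis imageI linear_span_image)
  also have "\<dots> \<subseteq> span B'"
    using assms(2) by (intro span_minimal) auto
  finally show ?thesis .
qed

lemma hodge_transpose_chain: "hodge_transpose n K k c \<in> chains K k" if "c \<in> dual_chains K k"
  using that unfolding dual_chains_def chains_def
  by (rule linear_image_in_span[rotated 2])
     (auto simp: hodge_transpose_oriented_dual span_base span_scale,
      simp add: hodge_transpose_def linear_lin_extend)

context isometric_symmetry
begin

lemma ordered_simplices_image: "map f vs \<in> ordered_simplices K k" if vs: "vs \<in> ordered_simplices K k"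
proof -
  obtain \<sigma> where \<sigma>: "\<sigma> \<in> K" "int k simplex \<sigma>" "vertex_ordering vs \<sigma>"
    using vs by (auto simp: ordered_simplices_def)
  have "vertex_ordering (map f vs) (f ` \<sigma>)"
    using \<sigma>(3) inj by (auto simp: vertex_ordering_def vertices_image distinct_map intro: inj_on_subset)
  then show ?thesis
    using \<sigma>(1,2) simplex_image image_in_complex unfolding ordered_simplices_def by blast
qed

lemma move_dual_chain_closed: "move_dual_chain f c \<in> dual_chains K k" if "c \<in> dual_chains K k"
  using that unfolding dual_chains_def
  by (rule linear_image_in_span[rotated 2])
     (auto simp: move_dual_chain_oriented_dual intro!: span_base ordered_simplices_image,
      simp add: move_dual_chain_def linear_lin_extend)

text \<open>
  Both composites are linear and send the dual of \<open>vs\<close> to a multiple of the oriented simplex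
  \<open>map f vs\<close>; the factors are the Hodge ratios of the image simplex and of the original one.
\<close>

lemma hodge_transpose_equivariant:
  "hodge_transpose n K k (move_dual_chain f c) = move_chain f (hodge_transpose n K k c)"
  if "c \<in> dual_chains K k"
proof (rule linear_eq_on[where f = "\<lambda>c. hodge_transpose n K k (move_dual_chain f c)"
      and g = "\<lambda>c. move_chain f (hodge_transpose n K k c)" and x = c])
  show "linear (\<lambda>c. hodge_transpose n K k (move_dual_chain f c))"
    and "linear (\<lambda>c. move_chain f (hodge_transpose n K k c))"
    unfolding hodge_transpose_def move_dual_chain_def move_chain_def
    using linear_compose[OF linear_lin_extend linear_lin_extend] by (auto simp: o_def)
  show "c \<in> span (oriented_dual ` ordered_simplices K k)"
    using that by (simp add: dual_chains_def)
  fix b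
  assume "b \<in> oriented_dual ` ordered_simplices K k"
  then obtain vs where b: "b = oriented_dual vs"
    by blast
  have "move_chain f (r *\<^sub>R oriented_simplex vs) = r *\<^sub>R oriented_simplex (map f vs)" for r
    by (metis linear_lin_extend linear_scale move_chain_def move_chain_oriented_simplex)
  then show "hodge_transpose n K k (move_dual_chain f b) = move_chain f (hodge_transpose n K k b)"
    by (simp add: b move_dual_chain_oriented_dual hodge_transpose_oriented_dual
        convex_hull_image hodge_ratio_image)
qed

end

text \<open>
  Cells are moved by \<open>g\<close> itself, while cochains are precomposed with the inverse of \<open>g\<close>, so
  the two parts apply the preceding results to different symmetries.
\<close>

theorem theorem4p3:
  fixes K :: "(real ^ 'N) set set" and ori :: "(real ^ 'N) set \<Rightarrow> (real ^ 'N) list"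
    and G :: "('g, 'm) monoid_scheme" and act :: "'g \<Rightarrow> real ^ 'N \<Rightarrow> real ^ 'N" and n :: nat
  assumes "oriented_complex n K ori"
    and "group G" and "finite (carrier G)"
    and "isometric_simplicial_action G K act"
  shows "(\<forall>g\<in>carrier G. \<forall>k. \<forall>\<sigma>\<in>K. int k simplex \<sigma> \<longrightarrow>
            move_cell (act g) (dual_cell n K k \<sigma>) = dual_cell n K k (act g ` \<sigma>)) \<and>
         (\<forall>k\<le>n. \<forall>g\<in>carrier G.
            compose (cochains K k) (hodge_star n K k) (cochain_rep G K act k g) =
            compose (cochains K k) (dual_cochain_rep G K act k g) (hodge_star n K k))"
proof (intro conjI ballI allI impI)
  have symmetry: "isometric_symmetry (act g) K" if "g \<in> carrier G" for g
    using assms(1,4) that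
    by unfold_locales
       (auto simp: oriented_complex_def isometric_simplicial_action_def simplicial_automorphism_def)
  fix g
  assume g: "g \<in> carrier G"
  show "move_cell (act g) (dual_cell n K k \<sigma>) = dual_cell n K k (act g ` \<sigma>)" for k \<sigma>
    using symmetry[OF g] by (rule isometric_symmetry.dual_cell_image)
  have "inv\<^bsub>G\<^esub> g \<in> carrier G"
    using assms(2) g by simp
  then interpret isometric_symmetry "act (inv\<^bsub>G\<^esub> g)" K
    by (rule symmetry)
  show "compose (cochains K k) (hodge_star n K k) (cochain_rep G K act k g) =
      compose (cochains K k) (dual_cochain_rep G K act k g) (hodge_star n K k)" for k
    \<comment> \<open>Both sides send \<open>\<alpha>\<close> to its precomposition with one of the two composites of
      \<open>hodge_transpose_equivariant\<close>. The closure lemmas place all arguments in the spaces of chains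
      and dual chains, where the restricted functions have their intended values.\<close>
    unfolding compose_def hodge_star_def cochain_rep_def dual_cochain_rep_def
      hodge_transpose_def[symmetric]
    by (intro restrict_ext)
       (simp add: hodge_transpose_chain move_dual_chain_closed hodge_transpose_equivariant)
qed

end
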